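(* Let $P(x_1,x_2)$ be a homogeneous polynomial of degree at least $2$ with integer (or rational) coefficients. If $P$ is irreducible over the field $\mathbb Q$, then the operator $$L=P\Bigl(-i\frac{\partial}{\partial x_1},-i\frac{\partial}{\partial x_2}\Bigr)$$ is hypoelliptic (on the torus).
   Context: For $m\in\mathbb R$, $H^m$ is the space of formal Fourier series $f=\sum_{n\in\mathbb Z\oplus\mathbb Z}f_n e^{inx}$ ($f_n\in\mathbb C$, $n=(n_1,n_2)$, $x=(x_1,x_2)$, $nx=n_1x_1+n_2x_2$) with finite norm $\|f\|_m^2=\sum_n(1+n\cdot n)^m|f_n|^2$ (periodic Sobolev spaces). $H^\infty=\bigcap_m H^m$ and $H^{-\infty}=\bigcup_m H^m$. The operator $L$ acts by $L\bigl(\sum_n f_ne^{inx}\bigr)=\sum_n P(n)f_ne^{inx}$. $L$ is called hypoelliptic if for any $u\in H^{-\infty}$ the inclusion $Lu\in H^\infty$ implies $u\in H^\infty$. *)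

theory Defs
  imports "HOL-Analysis.Analysis" "HOL-Computational_Algebra.Computational_Algebra"
begin

text \<open>A formal Fourier series on the two-dimensional torus is the family of its coefficients.\<close>

type_synonym fourier_series = "int \<times> int \<Rightarrow> complex"

definition sobolev :: "real \<Rightarrow> fourier_series set" where
  "sobolev m = {f. (\<lambda>(n1, n2). (1 + real_of_int (n1 * n1 + n2 * n2)) powr m
                      * (cmod (f (n1, n2)))\<^sup>2) summable_on UNIV}"

definition sobolev_inf :: "fourier_series set" where
  "sobolev_inf = (\<Inter>m. sobolev m)"

definition sobolev_neg_inf :: "fourier_series set" where
  "sobolev_neg_inf = (\<Union>m. sobolev m)"

definition hypoelliptic :: "(fourier_series \<Rightarrow> fourier_series) \<Rightarrow> bool" where
  "hypoelliptic L \<longleftrightarrow> (\<forall>u \<in> sobolev_neg_inf. L u \<in> sobolev_inf \<longrightarrow> u \<in> sobolev_inf)"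

text \<open>Termwise derivatives: \<open>e\<^sup>i\<^sup>n\<^sup>x\<close> is mapped to \<open>\<i> n\<^sub>1 e\<^sup>i\<^sup>n\<^sup>x\<close> and \<open>\<i> n\<^sub>2 e\<^sup>i\<^sup>n\<^sup>x\<close> respectively.\<close>

definition partial1 :: "fourier_series \<Rightarrow> fourier_series" where
  "partial1 f = (\<lambda>(n1, n2). \<i> * of_int n1 * f (n1, n2))"

definition partial2 :: "fourier_series \<Rightarrow> fourier_series" where
  "partial2 f = (\<lambda>(n1, n2). \<i> * of_int n2 * f (n1, n2))"

definition D1 :: "fourier_series \<Rightarrow> fourier_series" where
  "D1 f = (\<lambda>n. - \<i> * partial1 f n)"

definition D2 :: "fourier_series \<Rightarrow> fourier_series" where
  "D2 f = (\<lambda>n. - \<i> * partial2 f n)"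

text \<open>
  The ring \<open>\<rat>[x\<^sub>1, x\<^sub>2]\<close> is represented as \<open>\<rat>[x\<^sub>1][x\<^sub>2]\<close>: \<open>coeff (coeff P j) i\<close> is the
  coefficient of \<open>x\<^sub>1\<^sup>i x\<^sub>2\<^sup>j\<close>. The units of this ring are the nonzero constants, so
  \<open>irreducible\<close> on this type is irreducibility over the field \<open>\<rat>\<close>.
\<close>

definition homogeneous2 :: "nat \<Rightarrow> rat poly poly \<Rightarrow> bool" where
  "homogeneous2 d P \<longleftrightarrow> (\<forall>i j. coeff (coeff P j) i \<noteq> 0 \<longrightarrow> i + j = d)"

definition poly2 :: "rat poly poly \<Rightarrow> rat \<Rightarrow> rat \<Rightarrow> rat" where
  "poly2 P a b = poly (poly P [:b:]) a"

definition diff_op :: "rat poly poly \<Rightarrow> fourier_series \<Rightarrow> fourier_series" where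
  "diff_op P f = (\<lambda>n. \<Sum>j\<le>degree P. \<Sum>i\<le>degree (coeff P j).
      of_rat (coeff (coeff P j) i) *
      (D1 ^^ i) ((D2 ^^ j) f) n)"

lemma poly2_altdef:
  "poly2 P a b = (\<Sum>j\<le>degree P. \<Sum>i\<le>degree (coeff P j). coeff (coeff P j) i * a ^ i * b ^ j)"
  by (simp add: poly2_def poly_altdef[of P] poly_sum poly_altdef[of "coeff P _"]
        sum_distrib_right poly_power)

lemma D1_eq: "D1 f (n1, n2) = of_int n1 * f (n1, n2)"
  by (simp add: D1_def partial1_def mult.assoc [symmetric])

lemma D2_eq: "D2 f (n1, n2) = of_int n2 * f (n1, n2)"
  by (simp add: D2_def partial2_def mult.assoc [symmetric])

lemma funpow_D1: "(D1 ^^ i) f (n1, n2) = of_int n1 ^ i * f (n1, n2)"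
  by (induction i) (simp_all add: D1_eq)

lemma funpow_D2: "(D2 ^^ j) f (n1, n2) = of_int n2 ^ j * f (n1, n2)"
  by (induction j) (simp_all add: D2_eq)

lemma diff_op_eq_symbol:
  "diff_op P f (n1, n2) = of_rat (poly2 P (of_int n1) (of_int n2)) * f (n1, n2)"
  by (simp add: diff_op_def poly2_altdef funpow_D1 funpow_D2 of_rat_sum of_rat_mult
        of_rat_power sum_distrib_right mult.assoc)

lemma is_unit_poly2_iff:
  fixes P :: "rat poly poly"
  shows "is_unit P \<longleftrightarrow> (\<exists>c. c \<noteq> 0 \<and> P = [:[:c:]:])"
  by (auto simp: is_unit_poly_iff dvd_field_iff)

end

theory Submission
  imports Defs
begin

text \<open>
  On the Fourier side \<open>L\<close> multiplies the coefficient at \<open>n\<close> by the number \<open>P(n)\<close>, so it suffices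
  that \<open>\<bar>P(n)\<bar>\<close> is bounded below by a positive constant at all lattice points \<open>n \<noteq> 0\<close>:
  then \<open>u\<close> is dominated coefficientwise by \<open>L u\<close> up to a single coefficient, and every Sobolev norm of
  \<open>L u\<close> controls that of \<open>u\<close> (\<open>sobolev_dominated\<close>).

  The lower bound is arithmetic. A rational zero \<open>(a, b) \<noteq> (0, 0)\<close> of a homogeneous
  polynomial makes the linear form \<open>b x\<^sub>1 - a x\<^sub>2\<close> a factor, which irreducibility forbids in
  degree at least two (\<open>irreducible_homogeneous_no_zero\<close>). Hence \<open>P(n) \<noteq> 0\<close> for every
  lattice point \<open>n \<noteq> 0\<close>. Moreover, with \<open>N\<close> a common denominator of the coefficients,
  \<open>N P(n)\<close> is an integer (\<open>poly2_common_denominator\<close>), and a nonzero integer has absolute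
  value at least one; thus \<open>\<bar>P(n)\<bar> \<ge> 1 / N\<close>.
\<close>

lemma poly_rat_common_denominator:
  fixes p :: "rat poly"
  shows "\<exists>N::int. N > 0 \<and> (\<forall>x::int. of_int N * poly p (of_int x) \<in> \<int>)"
proof (induction p)
  case 0
  show ?case by (intro exI[of _ 1]) auto
next
  case (pCons c p)
  obtain N where N: "N > 0" "\<And>x::int. of_int N * poly p (of_int x) \<in> \<int>"
    using pCons.IH by blast
  obtain k l where kl: "quotient_of c = (k, l)" by fastforce
  have l: "l > 0" and c: "c = of_int k / of_int l"
    using quotient_of_denom_pos[OF kl] quotient_of_div[OF kl] by auto
  have "of_int (l * N) * poly (pCons c p) (of_int x) \<in> \<int>" for x :: int
  proof -
    have "of_int (l * N) * poly (pCons c p) (of_int x)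
        = of_int (N * k) + of_int (l * x) * (of_int N * poly p (of_int x))"
      using l by (simp add: c algebra_simps)
    also have "\<dots> \<in> \<int>" by (intro Ints_add Ints_mult N(2) Ints_of_int)
    finally show ?thesis .
  qed
  then show ?case using l N(1) by (intro exI[of _ "l * N"]) auto
qed

lemma poly2_common_denominator:
  "\<exists>N::int. N > 0 \<and> (\<forall>x y::int. of_int N * poly2 P (of_int x) (of_int y) \<in> \<int>)"
proof (induction P)
  case 0
  show ?case by (intro exI[of _ 1]) (auto simp: poly2_def)
next
  case (pCons p P)
  obtain N where N: "N > 0" "\<And>x y::int. of_int N * poly2 P (of_int x) (of_int y) \<in> \<int>"
    using pCons.IH by blast
  obtain M where M: "M > 0" "\<And>x::int. of_int M * poly p (of_int x) \<in> \<int>"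
    using poly_rat_common_denominator by blast
  have "of_int (M * N) * poly2 (pCons p P) (of_int x) (of_int y) \<in> \<int>" for x y :: int
  proof -
    have "of_int (M * N) * poly2 (pCons p P) (of_int x) (of_int y)
        = of_int N * (of_int M * poly p (of_int x))
          + of_int (M * y) * (of_int N * poly2 P (of_int x) (of_int y))"
      by (simp add: poly2_def algebra_simps)
    also have "\<dots> \<in> \<int>" by (intro Ints_add Ints_mult M(2) N(2) Ints_of_int)
    finally show ?thesis .
  qed
  then show ?case using M(1) N(1) by (intro exI[of _ "M * N"]) auto
qed

lemma homogeneous2_coeff:
  assumes "homogeneous2 d P"
  shows "coeff P j = monom (coeff (coeff P j) (d - j)) (d - j)"
  using assms unfolding homogeneous2_def by (intro poly_eqI) fastforce

lemma homogeneous2_coeff_eq_0: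
  assumes "homogeneous2 d P" "d < j"
  shows "coeff P j = 0"
  using assms unfolding homogeneous2_def by (intro poly_eqI) fastforce

text \<open>
  On the line \<open>x\<^sub>2 = t x\<^sub>1\<close> every monomial of degree \<open>d\<close> becomes a multiple of \<open>x\<^sub>1\<^sup>d\<close>, so a
  single zero of \<open>P\<close> on this line, other than the origin, forces the whole restriction to
  vanish.
\<close>

lemma homogeneous2_restrict_line:
  assumes "homogeneous2 d P"
  shows "poly P [:0, t:] = monom (poly2 P 1 t) d"
proof -
  have "coeff P j * [:0, t:] ^ j = monom (poly (coeff P j) 1 * t ^ j) d" for j
  proof (cases "j \<le> d")
    case True
    have "[:0, t:] ^ j = monom (t ^ j) j"
      by (induction j) (simp_all add: monom_altdef mult.commute)
    moreover obtain c where "coeff P j = monom c (d - j)"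
      using homogeneous2_coeff[OF assms] by blast
    ultimately show ?thesis
      using True by (simp add: mult_monom poly_monom)
  qed (simp add: homogeneous2_coeff_eq_0[OF assms])
  then have "poly P [:0, t:] = (\<Sum>j\<le>degree P. monom (poly (coeff P j) 1 * t ^ j) d)"
    by (simp add: poly_altdef)
  also have "\<dots> = monom (\<Sum>j\<le>degree P. poly (coeff P j) 1 * t ^ j) d"
    by (simp add: monom_sum)
  also have "(\<Sum>j\<le>degree P. poly (coeff P j) 1 * t ^ j) = poly2 P 1 t"
    by (simp add: poly2_def poly_altdef[of P] poly_sum)
  finally show ?thesis .
qed

text \<open>
  A zero \<open>(a, b)\<close> off the axis \<open>x\<^sub>1 = 0\<close> makes \<open>(b / a) x\<^sub>1\<close> a root of \<open>P\<close> as a polynomial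
  in \<open>x\<^sub>2\<close>, giving the factor \<open>x\<^sub>2 - (b / a) x\<^sub>1\<close>. A zero on that axis, other than the origin,
  kills the coefficient of \<open>x\<^sub>2\<^sup>d\<close>, and then every remaining monomial contains \<open>x\<^sub>1\<close>. By
  irreducibility the linear factor is all of \<open>P\<close> up to a constant, so \<open>P\<close> would have degree
  one.
\<close>

lemma irreducible_homogeneous_no_zero:
  assumes hom: "homogeneous2 d P" and irr: "irreducible P" and "d \<noteq> 1"
    and zero: "poly2 P a b = 0"
  shows "a = 0 \<and> b = 0"
proof (rule ccontr)
  assume nz: "\<not> (a = 0 \<and> b = 0)"
  show False
  proof (cases "a = 0")
    case False
    have "poly2 P a b = poly (poly P [:0, b / a:]) a"
      using False by (simp add: poly2_def poly_altdef[of P] poly_sum)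
    then have "poly2 P 1 (b / a) = 0"
      using zero False by (simp add: homogeneous2_restrict_line[OF hom] poly_monom)
    then have "[:- [:0, b / a:], 1:] dvd P"
      by (subst poly_eq_0_iff_dvd [symmetric]) (simp add: homogeneous2_restrict_line[OF hom])
    then obtain Q where Q: "P = [:- [:0, b / a:], 1:] * Q" by blast
    have "\<not> is_unit [:- [:0, b / a:], 1:]"
      by (auto simp: is_unit_poly2_iff)
    then obtain c where c: "c \<noteq> 0" "Q = [:[:c:]:]"
      using irreducibleD[OF irr Q] is_unit_poly2_iff by blast
    then have "coeff (coeff P 1) 0 \<noteq> 0" by (simp add: Q)
    then show False using hom \<open>d \<noteq> 1\<close> unfolding homogeneous2_def by fastforce
  next
    case True
    have axis: "poly2 P 0 t = coeff (coeff P d) 0 * t ^ d" for t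
    proof -
      have "poly2 P 0 t = (\<Sum>j\<le>degree P. coeff (coeff P j) 0 * t ^ j)"
        by (simp add: poly2_def poly_altdef[of P] poly_sum flip: poly_0_coeff_0)
      also have "\<dots> = (\<Sum>j\<le>degree P. if j = d then coeff (coeff P d) 0 * t ^ d else 0)"
        using hom unfolding homogeneous2_def by (intro sum.cong) fastforce+
      also have "\<dots> = coeff (coeff P d) 0 * t ^ d"
        by (auto simp: coeff_eq_0)
      finally show ?thesis .
    qed
    have top: "coeff (coeff P d) 0 = 0"
      using zero nz True axis[of b] by auto
    have "coeff (coeff P j) 0 = 0" for j
      using top hom unfolding homogeneous2_def by fastforce
    then have "[:0, 1:] dvd coeff P j" for j
      using poly_eq_0_iff_dvd[of "coeff P j" 0] by (simp add: poly_0_coeff_0)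
    then have "[:[:0, 1:]:] dvd P"
      by (simp add: const_poly_dvd_iff)
    then obtain Q where Q: "P = [:[:0, 1:]:] * Q" by blast
    have "\<not> is_unit ([:[:0, 1:]:] :: rat poly poly)"
      by (auto simp: is_unit_poly2_iff)
    then obtain c where c: "c \<noteq> 0" "Q = [:[:c:]:]"
      using irreducibleD[OF irr Q] is_unit_poly2_iff by blast
    then have "coeff (coeff P 0) 1 \<noteq> 0" by (simp add: Q)
    then show False using hom \<open>d \<noteq> 1\<close> unfolding homogeneous2_def by fastforce
  qed
qed

text \<open>
  Summability is unaffected by finitely many coefficients, so comparison of the weighted series
  is needed only outside a finite set.
\<close>

lemma sobolev_dominated:
  assumes v: "v \<in> sobolev m" and "finite F"
    and le: "\<And>n. n \<notin> F \<Longrightarrow> cmod (u n) \<le> C * cmod (v n)"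
  shows "u \<in> sobolev m"
proof -
  define W where "W f = (\<lambda>(n1, n2). (1 + real_of_int (n1 * n1 + n2 * n2)) powr m
                      * (cmod (f (n1, n2)))\<^sup>2)" for f :: fourier_series
  have "W v summable_on UNIV"
    using v by (simp add: sobolev_def W_def)
  then have "(\<lambda>n. C\<^sup>2 * W v n) summable_on (- F)"
    by (intro summable_on_cmult_right) (rule summable_on_subset_banach, auto)
  then have "W u summable_on (- F)"
  proof (rule summable_on_comparison_test)
    fix n assume "n \<in> - F"
    obtain n1 n2 where n: "n = (n1, n2)" by fastforce
    have "(cmod (u n))\<^sup>2 \<le> C\<^sup>2 * (cmod (v n))\<^sup>2"
      using power_mono[OF le, of n 2] \<open>n \<in> - F\<close> by (simp add: power_mult_distrib)
    then have "w powr m * (cmod (u n))\<^sup>2 \<le> w powr m * (C\<^sup>2 * (cmod (v n))\<^sup>2)" for w :: real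
      by (intro mult_left_mono) auto
    then show "W u n \<le> C\<^sup>2 * W v n"
      unfolding W_def n prod.case by (subst mult.left_commute)
  qed (auto simp: W_def)
  moreover have "W u summable_on F" using \<open>finite F\<close> by simp
  ultimately have "W u summable_on (F \<union> - F)"
    by (intro summable_on_Un_disjoint) auto
  then show ?thesis by (simp add: sobolev_def W_def)
qed

theorem proposition7:
  fixes P :: "rat poly poly" and d :: nat
  assumes "d \<ge> 2"
    and "homogeneous2 d P"
    and "irreducible P"
  shows "hypoelliptic (diff_op P)"
proof -
  obtain N :: int where N: "N > 0"
    "\<And>x y::int. of_int N * poly2 P (of_int x) (of_int y) \<in> \<int>"
    using poly2_common_denominator by blast
  have bound: "cmod (u n) \<le> of_int N * cmod (diff_op P u n)" if "n \<notin> {(0, 0)}" for u n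
  proof -
    obtain x y where n: "n = (x, y)" by fastforce
    define q where "q = poly2 P (of_int x) (of_int y)"
    have "q \<noteq> 0"
      using irreducible_homogeneous_no_zero[OF assms(2,3), of "of_int x" "of_int y"] assms(1) that n
      by (auto simp: q_def)
    obtain k where k: "of_int N * q = of_int k"
      using N(2)[of x y] unfolding q_def by (auto elim: Ints_cases)
    have "k \<noteq> 0" using k N(1) \<open>q \<noteq> 0\<close> by auto
    have "of_int N * (of_rat q :: complex) = of_rat (of_int N * q)"
      by (simp add: of_rat_mult)
    also have "\<dots> = of_int k" by (simp add: k)
    finally have "cmod (of_int N * of_rat q) = \<bar>of_int k\<bar>" by simp
    then have "1 \<le> of_int N * cmod (of_rat q)"
      using \<open>k \<noteq> 0\<close> N(1) by (simp add: norm_mult)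
    then have "1 * cmod (u n) \<le> of_int N * cmod (of_rat q) * cmod (u n)"
      by (intro mult_right_mono) auto
    then show ?thesis
      by (simp add: n diff_op_eq_symbol norm_mult q_def mult.assoc)
  qed
  have "u \<in> sobolev m" if "diff_op P u \<in> sobolev m" for u m
    by (rule sobolev_dominated[OF that, where F = "{(0, 0)}" and C = "of_int N"])
      (use bound in auto)
  then show ?thesis
    by (simp add: hypoelliptic_def sobolev_inf_def)
qed

end
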